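(* Let $c_\infty$ be the partial red-blue colouring of $\mathbb{R}/\mathbb{Z}$ defined below. Then $c_\infty$ contains no $(14,14)$-AP with common difference $d \in (-1/2, 0) \cup (0, 1/2)$ (viewing $d$ as an element of $\mathbb{R}/\mathbb{Z}$).
   Context: Identify $\mathbb{R}/\mathbb{Z}$ with $[0,1)$. A configuration is a partial red-blue colouring of $\mathbb{R}/\mathbb{Z}$ together with a partition of the uncoloured set into open intervals, each assigned a direction $\epsilon \in \{+1,-1\}$. The configuration $c_0$ is: $[0,1/4]$ red; $(1/4,1/2)$ uncoloured with direction $+1$; $[1/2,3/4]$ blue; $(3/4,1)$ uncoloured with direction $-1$. Replacement rule: for an uncoloured interval $(a,b)$ with direction $\epsilon$, let $f:[0,1]\to[a,b]$ be $f(x) = a+(b-a)x$ if $\epsilon=+1$ and $f(x) = b-(b-a)x$ if $\epsilon=-1$; replace $(a,b)$ by: $f((0,1/5))$ uncoloured with direction $\epsilon$; $f([1/5,2/5])$ blue; $f((2/5,3/5))$ uncoloured with direction $-\epsilon$; $f([3/5,4/5])$ red; $f((4/5,1))$ uncoloured with direction $\epsilon$. The configuration $c_{i+1}$ is obtained by applying this rule to every uncoloured interval of $c_i$. Since colours are never changed once assigned, define the partial colouring $c_\infty$ by colouring a point red (resp. blue) if some $c_i$ colours it red (resp. blue); some points remain uncoloured. For a partial colouring, an $(a,b)$-AP is an arithmetic progression $x, x+d, \dots, x+(a+b-1)d$ in $\mathbb{R}/\mathbb{Z}$ such that none of the first $a$ elements is blue and none of the last $b$ elements is red. *)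

theory Defs
  imports Complex_Main
begin

text \<open>
  The circle of reals modulo 1 is identified with the half-open interval from 0 to 1;
  a real number represents the point \<^term>\<open>frac x\<close>.
\<close>

record partial_colouring =
  red :: "real set"
  blue :: "real set"

text \<open>A triple \<open>(a, b, \<epsilon>)\<close> stands for the open interval from \<open>a\<close> to \<open>b\<close> with direction \<open>\<epsilon>\<close>.\<close>

record configuration = partial_colouring +
  gaps :: "(real \<times> real \<times> int) set"

definition gap_set :: "real \<times> real \<times> int \<Rightarrow> real set" where
  "gap_set = (\<lambda>(a, b, \<epsilon>). {a<..<b})"

text \<open>
  An interval may end at 1, which represents the same point as 0, but none of the
  intervals occurring below contains that point, so they need not wrap around.
\<close>

definition gap_ok :: "real \<times> real \<times> int \<Rightarrow> bool" where
  "gap_ok = (\<lambda>(a, b, \<epsilon>). 0 \<le> a \<and> a < b \<and> b \<le> 1 \<and> \<epsilon> \<in> {1, -1})"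

definition is_configuration :: "configuration \<Rightarrow> bool" where
  "is_configuration c \<longleftrightarrow>
     red c \<subseteq> {0..<1} \<and> blue c \<subseteq> {0..<1} \<and> red c \<inter> blue c = {} \<and>
     (\<forall>g \<in> gaps c. gap_ok g) \<and>
     (\<Union>g \<in> gaps c. gap_set g) = {0..<1} - (red c \<union> blue c) \<and>
     (\<forall>g \<in> gaps c. \<forall>h \<in> gaps c. g \<noteq> h \<longrightarrow> gap_set g \<inter> gap_set h = {})"

definition initial_config :: configuration where
  "initial_config =
     \<lparr>red = {0..1/4}, blue = {1/2..3/4}, gaps = {(1/4, 1/2, 1), (3/4, 1, -1)}\<rparr>"

definition gap_map :: "real \<times> real \<times> int \<Rightarrow> real \<Rightarrow> real" where
  "gap_map = (\<lambda>(a, b, \<epsilon>) x. if \<epsilon> = 1 then a + (b - a) * x else b - (b - a) * x)"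

text \<open>
  \<open>subgap g u v \<delta>\<close> encodes the image of the open interval from \<open>u\<close> to \<open>v\<close> under
  \<^term>\<open>gap_map g\<close>, with direction \<open>\<delta>\<close>; the map reverses orientation when \<open>g\<close> has direction -1.
\<close>

definition subgap :: "real \<times> real \<times> int \<Rightarrow> real \<Rightarrow> real \<Rightarrow> int \<Rightarrow> real \<times> real \<times> int" where
  "subgap g u v \<delta> =
     (min (gap_map g u) (gap_map g v), max (gap_map g u) (gap_map g v), \<delta>)"

definition replacement :: "real \<times> real \<times> int \<Rightarrow> (real \<times> real \<times> int) set" where
  "replacement = (\<lambda>(a, b, \<epsilon>).
     {subgap (a, b, \<epsilon>) 0 (1/5) \<epsilon>,
      subgap (a, b, \<epsilon>) (2/5) (3/5) (- \<epsilon>),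
      subgap (a, b, \<epsilon>) (4/5) 1 \<epsilon>})"

definition refine_config :: "configuration \<Rightarrow> configuration" where
  "refine_config c =
     \<lparr>red = red c \<union> (\<Union>g \<in> gaps c. gap_map g ` {3/5..4/5}),
      blue = blue c \<union> (\<Union>g \<in> gaps c. gap_map g ` {1/5..2/5}),
      gaps = (\<Union>g \<in> gaps c. replacement g)\<rparr>"

primrec config :: "nat \<Rightarrow> configuration" where
  "config 0 = initial_config"
| "config (Suc i) = refine_config (config i)"

definition limit_colouring :: partial_colouring where
  "limit_colouring = \<lparr>red = (\<Union>i. red (config i)), blue = (\<Union>i. blue (config i))\<rparr>"

text \<open>The progression with real representatives \<open>x\<close> of the first term and \<open>d\<close> of the difference.\<close>

definition is_AP :: "partial_colouring \<Rightarrow> nat \<Rightarrow> nat \<Rightarrow> real \<Rightarrow> real \<Rightarrow> bool" where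
  "is_AP p a b x d \<longleftrightarrow>
     (\<forall>i<a. frac (x + real i * d) \<notin> blue p) \<and>
     (\<forall>i\<in>{a..<a + b}. frac (x + real i * d) \<notin> red p)"

lemma is_configuration_initial: "is_configuration initial_config"
  unfolding is_configuration_def initial_config_def gap_set_def gap_ok_def by auto

lemma gap_map_image:
  assumes "a < b" "\<epsilon> \<in> {1, -1}" "u \<le> v"
  shows "gap_map (a, b, \<epsilon>) ` {u..v} =
    (if \<epsilon> = 1 then {a + (b - a) * u..a + (b - a) * v} else {b - (b - a) * v..b - (b - a) * u})"
proof (cases "\<epsilon> = 1")
  case True
  then have "gap_map (a, b, \<epsilon>) = (\<lambda>x. (b - a) * x + a)"
    by (auto simp: gap_map_def)
  then show ?thesis
    using assms True by (simp only: image_affinity_atLeastAtMost) (simp add: add.commute)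
next
  case False
  then have "gap_map (a, b, \<epsilon>) = (\<lambda>x. (a - b) * x + b)"
    by (auto simp: gap_map_def algebra_simps)
  then have "gap_map (a, b, \<epsilon>) ` {u..v} = {(a - b) * v + b..(a - b) * u + b}"
    using assms by (simp only: image_affinity_atLeastAtMost) simp
  moreover have "(a - b) * y + b = b - (b - a) * y" for y
    by (simp add: algebra_simps)
  ultimately show ?thesis
    using False by (simp only: if_False)
qed

lemma replacement_facts:
  assumes "gap_ok g"
  defines "R \<equiv> gap_map g ` {3/5..4/5}" and "B \<equiv> gap_map g ` {1/5..2/5}"
  shows "gap_set g = R \<union> B \<union> (\<Union>h \<in> replacement g. gap_set h)"
    and "R \<inter> B = {}" and "(R \<union> B) \<inter> (\<Union>h \<in> replacement g. gap_set h) = {}"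
    and "\<forall>h \<in> replacement g. gap_ok h"
    and "\<forall>h \<in> replacement g. \<forall>k \<in> replacement g. h \<noteq> k \<longrightarrow> gap_set h \<inter> gap_set k = {}"
proof -
  obtain a b \<epsilon> where g: "g = (a, b, \<epsilon>)" by (cases g)
  define l where "l = (b - a) / 5"
  have b: "b = a + 5 * l" unfolding l_def by (simp add: field_simps)
  have ok: "0 \<le> a" "0 < l" "a + 5 * l \<le> 1" "\<epsilon> = 1 \<or> \<epsilon> = -1"
    using assms(1) by (auto simp: gap_ok_def g b)
  have R: "R = (if \<epsilon> = 1 then {a + 3 * l..a + 4 * l} else {a + l..a + 2 * l})"
    using ok unfolding R_def g b by (subst gap_map_image) auto
  have B: "B = (if \<epsilon> = 1 then {a + l..a + 2 * l} else {a + 3 * l..a + 4 * l})"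
    using ok unfolding B_def g b by (subst gap_map_image) auto
  have rep: "replacement g = {(a, a + l, \<epsilon>), (a + 2 * l, a + 3 * l, - \<epsilon>), (a + 4 * l, a + 5 * l, \<epsilon>)}"
    using ok unfolding g b replacement_def subgap_def gap_map_def by (auto simp: min_def max_def)
  show "gap_set g = R \<union> B \<union> (\<Union>h \<in> replacement g. gap_set h)"
    using ok unfolding rep R B by (auto simp: g b gap_set_def)
  show "R \<inter> B = {}" using ok unfolding R B by auto
  show "(R \<union> B) \<inter> (\<Union>h \<in> replacement g. gap_set h) = {}"
    using ok unfolding rep R B by (auto simp: gap_set_def)
  show "\<forall>h \<in> replacement g. gap_ok h" using ok unfolding rep by (auto simp: gap_ok_def)
  show "\<forall>h \<in> replacement g. \<forall>k \<in> replacement g. h \<noteq> k \<longrightarrow> gap_set h \<inter> gap_set k = {}"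
    using ok unfolding rep by (auto simp: gap_set_def)
qed

lemma is_configuration_refine:
  assumes "is_configuration c"
  shows "is_configuration (refine_config c)"
proof -
  define R B N where "R g = gap_map g ` {3/5..4/5}" and "B g = gap_map g ` {1/5..2/5}"
    and "N g = (\<Union>h \<in> replacement g. gap_set h)" for g
  have c: "red c \<subseteq> {0..<1}" "blue c \<subseteq> {0..<1}" "red c \<inter> blue c = {}"
    "\<And>g. g \<in> gaps c \<Longrightarrow> gap_ok g"
    "(\<Union>g \<in> gaps c. gap_set g) = {0..<1} - (red c \<union> blue c)"
    "\<And>g h. g \<in> gaps c \<Longrightarrow> h \<in> gaps c \<Longrightarrow> g \<noteq> h \<Longrightarrow> gap_set g \<inter> gap_set h = {}"
    using assms unfolding is_configuration_def by simp_all
  have ok: "gap_ok g" if "g \<in> gaps c" for g using c(4) that .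
  have split: "gap_set g = R g \<union> B g \<union> N g" "R g \<inter> B g = {}" "(R g \<union> B g) \<inter> N g = {}"
    if "g \<in> gaps c" for g
    unfolding R_def B_def N_def by (fact replacement_facts(1-3)[OF ok[OF that]])+
  have disj: "g = h" if "g \<in> gaps c" "h \<in> gaps c" "x \<in> gap_set g" "x \<in> gap_set h" for g h x
    using c(6)[OF that(1,2)] that(3,4) by blast
  have un: "x \<in> {0..<1}" "x \<notin> red c" "x \<notin> blue c" if "g \<in> gaps c" "x \<in> gap_set g" for g x
  proof -
    have "x \<in> {0..<1} - (red c \<union> blue c)" unfolding c(5)[symmetric] using that by blast
    then show "x \<in> {0..<1}" "x \<notin> red c" "x \<notin> blue c" by simp_all
  qed
  have cover: "\<exists>g \<in> gaps c. x \<in> gap_set g" if "x \<in> {0..<1}" "x \<notin> red c" "x \<notin> blue c" for x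
  proof -
    have "x \<in> (\<Union>g \<in> gaps c. gap_set g)" unfolding c(5) using that by simp
    then show ?thesis by blast
  qed
  define r b where "r = red c \<union> (\<Union>g \<in> gaps c. R g)" and "b = blue c \<union> (\<Union>g \<in> gaps c. B g)"
  have eqs: "red (refine_config c) = r" "blue (refine_config c) = b"
    "gaps (refine_config c) = (\<Union>g \<in> gaps c. replacement g)"
    by (simp_all add: refine_config_def r_def b_def R_def B_def)
  have in_gap: "x \<in> gap_set g" if "g \<in> gaps c" "x \<in> R g \<or> x \<in> B g \<or> x \<in> N g" for g x
    using split(1)[OF that(1)] that(2) by blast
  have RB: "R g \<subseteq> {0..<1} - (red c \<union> blue c)" "B g \<subseteq> {0..<1} - (red c \<union> blue c)"
    if "g \<in> gaps c" for g
    using un[OF that in_gap[OF that]] by auto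
  have "r \<subseteq> {0..<1}" "b \<subseteq> {0..<1}"
    using c(1,2) RB unfolding r_def b_def by (intro Un_least UN_least; blast)+
  moreover have "r \<inter> b = {}"
  proof -
    have False if R: "x \<in> R g" and B: "x \<in> B h" and gh: "g \<in> gaps c" "h \<in> gaps c" for x g h
    proof -
      have "g = h" using disj[OF gh] in_gap[OF gh(1)] in_gap[OF gh(2)] R B by blast
      then show False using split(2)[OF gh(1)] R B by blast
    qed
    moreover have "R g \<inter> blue c = {}" "B g \<inter> red c = {}" if "g \<in> gaps c" for g
      using RB[OF that] by blast+
    ultimately show ?thesis using c(3) unfolding r_def b_def by blast
  qed
  moreover have "\<forall>h \<in> (\<Union>g \<in> gaps c. replacement g). gap_ok h"
    using replacement_facts(4)[OF ok] by blast
  moreover have "(\<Union>h \<in> (\<Union>g \<in> gaps c. replacement g). gap_set h) = {0..<1} - (r \<union> b)"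
  proof -
    have N: "(\<Union>h \<in> (\<Union>g \<in> gaps c. replacement g). gap_set h) = (\<Union>g \<in> gaps c. N g)"
      by (simp add: N_def)
    have 1: "x \<in> {0..<1} - (r \<union> b)" if "g \<in> gaps c" "x \<in> N g" for g x
    proof -
      have x: "x \<in> gap_set g" using in_gap that by blast
      have "x \<notin> R h \<and> x \<notin> B h" if "h \<in> gaps c" for h
        using disj[OF \<open>g \<in> gaps c\<close> that x] in_gap[OF that] split(3)[OF \<open>g \<in> gaps c\<close>] \<open>x \<in> N g\<close>
        by blast
      then show ?thesis using un[OF that(1) x] unfolding r_def b_def by blast
    qed
    have 2: "\<exists>g \<in> gaps c. x \<in> N g" if x: "x \<in> {0..<1} - (r \<union> b)" for x
    proof -
      obtain g where "g \<in> gaps c" "x \<in> gap_set g"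
        using cover[of x] x unfolding r_def b_def by auto
      then show ?thesis using split(1) x unfolding r_def b_def by blast
    qed
    show ?thesis unfolding N using 1 2 by blast
  qed
  moreover have "gap_set h \<inter> gap_set k = {}"
    if h: "g \<in> gaps c" "h \<in> replacement g" and k: "g' \<in> gaps c" "k \<in> replacement g'"
      and "h \<noteq> k" for g g' h k
  proof (cases "g = g'")
    case True
    then show ?thesis using replacement_facts(5)[OF ok[OF h(1)]] h k \<open>h \<noteq> k\<close> by blast
  next
    case False
    have "gap_set h \<subseteq> gap_set g" "gap_set k \<subseteq> gap_set g'"
      using in_gap h k unfolding N_def by blast+
    then show ?thesis using disj[OF h(1) k(1)] False by blast
  qed
  ultimately show ?thesis
    unfolding is_configuration_def eqs by auto
qed

theorem is_configuration_config: "is_configuration (config i)"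
  by (induction i) (simp_all add: is_configuration_initial is_configuration_refine)

lemma config_mono:
  "i \<le> j \<Longrightarrow> red (config i) \<subseteq> red (config j) \<and> blue (config i) \<subseteq> blue (config j)"
  by (induction j rule: dec_induct) (auto simp: refine_config_def)

lemma limit_colouring_disjoint: "red limit_colouring \<inter> blue limit_colouring = {}"
proof -
  have False if "x \<in> red (config i)" "x \<in> blue (config j)" for x i j
    using that config_mono[of i "max i j"] config_mono[of j "max i j"]
      is_configuration_config[of "max i j"]
    unfolding is_configuration_def by (auto simp: disjoint_iff)
  then show ?thesis by (auto simp: limit_colouring_def)
qed

end

theory Submission
  imports Defs
begin

text \<open>
  Lift the colouring to the real line and number the coloured intervals of \<open>c\<^sub>k\<close> by the
  integers, so that they are alternately red and blue; consecutive ones are separated by gaps of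
  length \<open>\<ell> = 5\<^sup>-\<^sup>k/4\<close>, they have length at least \<open>\<ell>\<close>, and of two neighbours at least one has
  length exactly \<open>\<ell>\<close>. Translation by 1/2 exchanges the colours, so we may take \<open>d > 0\<close>.

  If \<open>d \<le> \<ell>\<close>, neither half of the progression can jump over a forbidden interval, so the halves
  lie in overlapping windows (gap, interval, gap), one of which has length \<open>3\<ell>\<close>. The fourth and
  the eleventh of the 14 points in that window then avoid the two forbidden intervals
  of \<open>c\<^sub>k\<^sub>+\<^sub>1\<close> inside it only if \<open>d \<le> \<ell>/5\<close>. Descending, \<open>d \<le> 1/4\<close> is impossible.

  If \<open>d = 1/2 - \<delta>\<close> with \<open>\<delta> \<le> 1/8\<close>, then translating every other point by 1/2 gives a progression
  of difference \<open>-\<delta>\<close> that alternately avoids blue and red. If \<open>2\<delta> \<le> \<ell>\<close>, it is trapped in a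
  single gap, whence \<open>2\<delta> \<le> \<ell>/5\<close>, and again one descends.

  If \<open>1/4 < d < 3/8\<close>, the first half must jump over the blue interval of \<open>c\<^sub>0\<close> at every third step.
  Four such jumps force \<open>d\<close> close to 1/3, and then one of the next terms is in the red interval.
\<close>

section \<open>The colouring lifted to the real line\<close>

definition scale :: "nat \<Rightarrow> real" where
  "scale k = 1 / (4 * 5 ^ k)"

text \<open>Left end of the \<open>n\<close>-th gap of \<open>c\<^sub>k\<close>; its direction is +1 iff \<open>n\<close> is even.\<close>

primrec gap_left :: "nat \<Rightarrow> int \<Rightarrow> real" where
  "gap_left 0 n = n / 2 + 1 / 4"
| "gap_left (Suc k) n = gap_left k (n div 3) + 2 * (n mod 3) * scale (Suc k)"

text \<open>The coloured interval between the gaps \<open>n - 1\<close> and \<open>n\<close>: red if \<open>n\<close> is even, blue if it is odd.\<close>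

definition arc :: "nat \<Rightarrow> int \<Rightarrow> real set" where
  "arc k n = {gap_left k (n - 1) + scale k..gap_left k n}"

text \<open>Only the parity of \<open>p\<close> matters: \<open>clear 1\<close> stands for not blue, \<open>clear 0\<close> for not red.\<close>

definition clear :: "int \<Rightarrow> real \<Rightarrow> bool" where
  "clear p y \<longleftrightarrow> (\<forall>k n. even (n + p) \<longrightarrow> y \<notin> arc k n)"

lemma scale_pos [simp]: "0 < scale k"
  by (simp add: scale_def)

lemma scale_Suc: "scale k = 5 * scale (Suc k)"
  by (simp add: scale_def)

lemma scale_arbitrarily_small:
  assumes "0 < e"
  obtains k where "scale k < e"
proof -
  obtain k where "(1 / 5 :: real) ^ k < e"
    using real_arch_pow_inv[OF assms, of "1 / 5"] by auto
  moreover have "scale k \<le> (1 / 5) ^ k"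
    by (simp add: scale_def field_simps)
  ultimately show ?thesis
    using that le_less_trans by blast
qed

section \<open>Ternary numbering and agreement with the configurations\<close>

lemma gap_left_triple:
  "gap_left (Suc k) (3 * n) = gap_left k n"
  "gap_left (Suc k) (3 * n + 1) = gap_left k n + 2 * scale (Suc k)"
  "gap_left (Suc k) (3 * n + 2) = gap_left k n + 4 * scale (Suc k)"
proof -
  have "(3 * n + 1) div 3 = n" "(3 * n + 1) mod 3 = 1" "(3 * n + 2) div 3 = n" "(3 * n + 2) mod 3 = 2"
    by presburger+
  then show "gap_left (Suc k) (3 * n) = gap_left k n"
    "gap_left (Suc k) (3 * n + 1) = gap_left k n + 2 * scale (Suc k)"
    "gap_left (Suc k) (3 * n + 2) = gap_left k n + 4 * scale (Suc k)"
    by simp_all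
qed

declare gap_left.simps(2) [simp del]

lemma int_mod_3_cases:
  obtains m :: int where "n = 3 * m" | m where "n = 3 * m + 1" | m where "n = 3 * m + 2"
proof -
  have "n = 3 * (n div 3) \<or> n = 3 * (n div 3) + 1 \<or> n = 3 * (n div 3) + 2"
    by presburger
  then show ?thesis
    using that by blast
qed

text \<open>The integer \<open>z\<close> moves the lifted gap into the unit interval. Gap
  \<open>m\<close> splits into gaps \<open>3 * m\<close>, \<open>3 * m + 1\<close>,
  \<open>3 * m + 2\<close> from left to right for either direction, and only the middle index
  changes parity, just as only the middle direction flips.\<close>

lemma gap_in_config:
  "\<exists>z::int. (gap_left k n - z, gap_left k n - z + scale k, if even n then 1 else -1) \<in> gaps (config k)"
proof (induction k arbitrary: n)
  case 0
  show ?case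
  proof (cases "even n")
    case True
    then obtain z where "n = 2 * z" by blast
    then show ?thesis
      by (intro exI[of _ z]) (simp add: initial_config_def scale_def)
  next
    case False
    then obtain z where "n = 2 * z + 1" by (rule oddE)
    then show ?thesis
      by (intro exI[of _ z]) (simp add: initial_config_def scale_def field_simps)
  qed
next
  case (Suc k)
  define l where "l = scale (Suc k)"
  have l: "0 < l" "scale k = 5 * l"
    by (simp_all add: l_def scale_Suc[of k])
  have rep: "replacement (a, a + 5 * l, \<epsilon>) =
      {(a, a + l, \<epsilon>), (a + 2 * l, a + 3 * l, - \<epsilon>), (a + 4 * l, a + 5 * l, \<epsilon>)}"
    if "\<epsilon> = 1 \<or> \<epsilon> = -1" for a \<epsilon>
    using that l(1) unfolding replacement_def subgap_def gap_map_def by (auto simp: min_def max_def)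
  obtain m r :: int where n: "n = 3 * m + r" and r: "r = 0 \<or> r = 1 \<or> r = 2"
  proof (cases n rule: int_mod_3_cases)
    case (1 m)
    then show ?thesis using that[of m 0] by simp
  qed (use that in blast)+
  define \<epsilon> :: int where "\<epsilon> = (if even m then 1 else -1)"
  obtain z :: int where z: "(gap_left k m - z, gap_left k m - z + 5 * l, \<epsilon>) \<in> gaps (config k)"
    using Suc.IH[of m] unfolding l(2) \<epsilon>_def by blast
  have "(gap_left (Suc k) n - z, gap_left (Suc k) n - z + l, if even n then 1 else -1)
      \<in> replacement (gap_left k m - z, gap_left k m - z + 5 * l, \<epsilon>)"
    using r gap_left_triple[of k m] unfolding n by (subst rep) (auto simp: \<epsilon>_def simp flip: l_def)
  then have "(gap_left (Suc k) n - z, gap_left (Suc k) n - z + l, if even n then 1 else -1)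
      \<in> gaps (config (Suc k))"
    using z unfolding config.simps refine_config_def by auto
  then show ?case
    unfolding l_def by blast
qed

text \<open>At each level, arc \<open>3 * m\<close> is the old arc \<open>m\<close>, while arcs
  \<open>3 * m + 1\<close> and \<open>3 * m + 2\<close> are the two coloured in gap
  \<open>m\<close>: blue then red if \<open>m\<close> is even, red then blue if it is odd.\<close>

lemma arc_coloured:
  assumes "y \<in> arc k n"
  shows "frac y \<in> (if even n then red limit_colouring else blue limit_colouring)"
proof -
  have "frac y \<in> (if even n then red (config k) else blue (config k))"
    using assms
  proof (induction k arbitrary: n)
    case 0
    show ?case
    proof (cases "even n")
      case True
      then obtain z where z: "n = 2 * z" by blast
      with 0 have "0 \<le> y - z" "y - z \<le> 1 / 4"
        by (auto simp: arc_def scale_def field_simps)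
      moreover from this have "frac y = y - z"
        by (subst frac_unique_iff) auto
      ultimately show ?thesis
        using True by (simp add: initial_config_def)
    next
      case False
      then obtain z where z: "n = 2 * z + 1" by (rule oddE)
      with 0 have "1 / 2 \<le> y - z" "y - z \<le> 3 / 4"
        by (auto simp: arc_def scale_def field_simps)
      moreover from this have "frac y = y - z"
        by (subst frac_unique_iff) auto
      ultimately show ?thesis
        using False by (simp add: initial_config_def)
    qed
  next
    case (Suc k)
    define l where "l = scale (Suc k)"
    have l: "0 < l" "scale k = 5 * l"
      by (simp_all add: l_def scale_Suc[of k])
    have new: "frac y \<in> (if even n then red (config (Suc k)) else blue (config (Suc k)))"
      if n: "n = 3 * m + r" and r: "r = 1 \<and> y \<in> {gap_left k m + l..gap_left k m + 2 * l} \<or>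
        r = 2 \<and> y \<in> {gap_left k m + 3 * l..gap_left k m + 4 * l}" for m r
    proof -
      obtain z :: int
        where z: "(gap_left k m - z, gap_left k m - z + 5 * l, if even m then 1 else -1) \<in> gaps (config k)"
          (is "?g \<in> _")
        using gap_in_config[of k m] unfolding l(2) by blast
      then have "gap_ok ?g"
        using is_configuration_config[of k] unfolding is_configuration_def by blast
      then have "frac y = y - z"
        using r l(1) by (subst frac_unique_iff) (auto simp: gap_ok_def)
      moreover have "y - z \<in> gap_map ?g ` (if even n then {3/5..4/5} else {1/5..2/5})"
      proof (cases "even m")
        case True
        then show ?thesis
          using r l(1) unfolding n by (auto simp: gap_map_image)
      next
        case False
        then show ?thesis
          using r l(1) unfolding n by (auto simp: gap_map_image)
      qed
      ultimately show ?thesis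
        using z by (auto simp: refine_config_def split: if_splits)
    qed
    show ?case
    proof (cases n rule: int_mod_3_cases)
      case (1 m)
      have "gap_left (Suc k) (n - 1) = gap_left k (m - 1) + 4 * l"
        using gap_left_triple(3)[of k "m - 1"] by (simp add: 1 l_def algebra_simps)
      then have "y \<in> arc k m"
        using Suc.prems gap_left_triple(1)[of k m] unfolding arc_def 1 l(2) by (simp flip: l_def)
      from Suc.IH[OF this] show ?thesis
        using config_mono[of k "Suc k"] by (auto simp: 1 split: if_splits)
    next
      case (2 m)
      then show ?thesis
        using Suc.prems gap_left_triple[of k m] by (intro new[of m 1]) (simp_all add: arc_def flip: l_def)
    next
      case (3 m)
      then show ?thesis
        using Suc.prems gap_left_triple[of k m]
        by (intro new[of m 2]) (simp_all add: arc_def add.commute flip: l_def)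
    qed
  qed
  then show ?thesis
    by (auto simp: limit_colouring_def split: if_splits)
qed

lemma clear_if_not_coloured:
  "frac y \<notin> blue limit_colouring \<Longrightarrow> clear 1 y"
  "frac y \<notin> red limit_colouring \<Longrightarrow> clear 0 y"
  using arc_coloured[of y] by (fastforce simp: clear_def)+

section \<open>Half-turn symmetry\<close>

lemma clear_cong: "even (p + q) \<Longrightarrow> clear p y \<Longrightarrow> clear q y"
  unfolding clear_def by (metis even_add)

text \<open>Each half-turn contains \<open>3 ^ k\<close> gaps. This number is odd, which is why a
  half-turn exchanges the colours.\<close>

lemma gap_left_translate: "gap_left k (n + j * 3 ^ k) = gap_left k n + j / 2"
proof (induction k arbitrary: n)
  case (Suc k)
  have "n + j * 3 ^ Suc k = n + 3 * (j * 3 ^ k)"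
    by simp
  then have "(n + j * 3 ^ Suc k) div 3 = n div 3 + j * 3 ^ k" "(n + j * 3 ^ Suc k) mod 3 = n mod 3"
    by (simp_all only: div_mult_self2 mod_mult_self2 zero_neq_numeral[symmetric] not_False_eq_True)
  then show ?case
    by (simp add: gap_left.simps(2) Suc.IH)
qed (simp add: field_simps)

lemma clear_translate:
  assumes "clear p y"
  shows "clear (p + j) (y + j / 2)"
  unfolding clear_def
proof (intro allI impI notI)
  fix k n
  assume even: "even (n + (p + j))" and mem: "y + j / 2 \<in> arc k n"
  have "gap_left k (n - j * 3 ^ k) = gap_left k n - j / 2"
    "gap_left k (n - j * 3 ^ k - 1) = gap_left k (n - 1) - j / 2"
    using gap_left_translate[of k n "- j"] gap_left_translate[of k "n - 1" "- j"]
    by (simp_all add: algebra_simps)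
  then have "y \<in> arc k (n - j * 3 ^ k)"
    using mem by (simp add: arc_def algebra_simps)
  moreover have "even (n - j * 3 ^ k + p)"
    using even by auto
  ultimately show False
    using assms by (auto simp: clear_def)
qed

section \<open>Spacing of the gaps\<close>

lemma gap_left_Suc_ge: "gap_left k n + 2 * scale k \<le> gap_left k (n + 1)"
proof (induction k arbitrary: n)
  case (Suc k)
  show ?case
  proof (cases n rule: int_mod_3_cases)
    case (3 m)
    have "gap_left (Suc k) (n + 1) = gap_left k (m + 1)"
      using gap_left_triple(1)[of k "m + 1"] by (simp add: 3 algebra_simps)
    then show ?thesis
      using Suc.IH[of m] gap_left_triple(3)[of k m] scale_pos[of "Suc k"]
      unfolding scale_Suc[of k] 3 by linarith
  qed (use gap_left_triple[of k] in \<open>simp_all add: add.commute\<close>)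
qed (simp add: scale_def field_simps)

text \<open>For \<open>k > 0\<close>, an arc whose index is not a multiple of 3 is new at level
  \<open>k\<close>, hence of minimal length; at level 0 all arcs have length 1/4.\<close>

lemma gap_left_Suc_eq:
  assumes "\<not> 3 dvd n + 1"
  shows "gap_left k (n + 1) = gap_left k n + 2 * scale k"
proof (cases k)
  case (Suc k')
  show ?thesis
  proof (cases n rule: int_mod_3_cases)
    case (3 m)
    then have "n + 1 = 3 * (m + 1)" by simp
    then show ?thesis using assms by simp
  qed (use gap_left_triple[of k'] in \<open>simp_all add: Suc add.commute\<close>)
qed (simp add: scale_def field_simps)

lemma gap_left_add_ge: "gap_left k n + 2 * j * scale k \<le> gap_left k (n + int j)"
proof (induction j)
  case (Suc j)
  then show ?case
    using gap_left_Suc_ge[of k "n + int j"] by (simp add: algebra_simps)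
qed simp

lemma gap_left_mono:
  assumes "n \<le> m"
  shows "gap_left k n \<le> gap_left k m"
proof -
  have "0 \<le> 2 * real (nat (m - n)) * scale k"
    using less_imp_le[OF scale_pos[of k]] by (intro mult_nonneg_nonneg) auto
  then show ?thesis
    using gap_left_add_ge[of k n "nat (m - n)"] assms by simp
qed

section \<open>Windows between forbidden arcs\<close>

lemma gap_left_bracket: "\<exists>n. gap_left k n \<le> y \<and> y < gap_left k (n + 1)"
proof (induction k)
  case 0
  have "\<lfloor>2 * y - 1 / 2\<rfloor> \<le> 2 * y - 1 / 2" "2 * y - 1 / 2 < \<lfloor>2 * y - 1 / 2\<rfloor> + 1"
    by linarith+
  then show ?case
    by (intro exI[of _ "\<lfloor>2 * y - 1 / 2\<rfloor>"]) (simp add: field_simps)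
next
  case (Suc k)
  then obtain m where m: "gap_left k m \<le> y" "y < gap_left k (m + 1)" by blast
  define l where "l = scale (Suc k)"
  consider "y < gap_left k m + 2 * l" | "gap_left k m + 2 * l \<le> y" "y < gap_left k m + 4 * l"
    | "gap_left k m + 4 * l \<le> y"
    by linarith
  then show ?case
  proof cases
    case 1
    then show ?thesis
      using m gap_left_triple[of k m] by (intro exI[of _ "3 * m"]) (simp flip: l_def)
  next
    case 2
    then show ?thesis
      using m gap_left_triple[of k m]
      by (intro exI[of _ "3 * m + 1"]) (simp add: add.assoc flip: l_def)
  next
    case 3
    then show ?thesis
      using m gap_left_triple(3)[of k m] gap_left_triple(1)[of k "m + 1"]
      by (intro exI[of _ "3 * m + 2"]) (simp add: algebra_simps flip: l_def)
  qed
qed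

text \<open>The window consists of gap \<open>n\<close>, the allowed arc \<open>n + 1\<close> and
  gap \<open>n + 1\<close>; the forbidden arcs \<open>n\<close> and \<open>n + 2\<close> bound
  it.\<close>

lemma clear_window:
  assumes "clear p y"
  obtains n where "even (n + p)" "gap_left k n < y" "y < gap_left k (n + 1) + scale k"
proof -
  obtain n where n: "gap_left k n \<le> y" "y < gap_left k (n + 1)"
    using gap_left_bracket by blast
  have not_arc: "y \<notin> arc k m" if "even (m + p)" for m
    using assms that by (auto simp: clear_def)
  show ?thesis
  proof (cases "even (n + p)")
    case True
    have "gap_left k (n - 1) + scale k \<le> gap_left k n"
      using gap_left_Suc_ge[of k "n - 1"] by simp (use scale_pos[of k] in linarith)
    then have "y \<noteq> gap_left k n"
      using not_arc[OF True] by (auto simp: arc_def)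
    then show ?thesis
      using that[OF True] n scale_pos[of k] by linarith
  next
    case False
    then have "y < gap_left k n + scale k"
      using not_arc[of "n + 1"] n by (auto simp: arc_def)
    moreover have "gap_left k (n - 1) < y"
      using gap_left_Suc_ge[of k "n - 1"] n by simp (use scale_pos[of k] in linarith)
    ultimately show ?thesis
      using that[of "n - 1"] False by simp
  qed
qed

text \<open>The arcs of \<open>c\<^sub>k\<close> have length at least \<open>scale k\<close>, so the sequence cannot jump over one.\<close>

lemma clear_chain_window:
  assumes "\<And>i. i \<le> N \<Longrightarrow> clear p (f i)"
    and "\<And>i. i < N \<Longrightarrow> f i \<le> f (Suc i)"
    and "\<And>i. i < N \<Longrightarrow> f (Suc i) \<le> f i + scale k"
  obtains n where "even (n + p)"
    "\<And>i. i \<le> N \<Longrightarrow> gap_left k n < f i \<and> f i < gap_left k (n + 1) + scale k"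
proof -
  obtain n where n: "even (n + p)" "gap_left k n < f 0" "f 0 < gap_left k (n + 1) + scale k"
    using clear_window[OF assms(1)[of 0]] by blast
  have "gap_left k n < f i \<and> f i < gap_left k (n + 1) + scale k" if "i \<le> N" for i
    using that
  proof (induction i)
    case 0
    then show ?case using n by simp
  next
    case (Suc i)
    then have IH: "gap_left k n < f i" "f i < gap_left k (n + 1) + scale k"
      and step: "f i \<le> f (Suc i)" "f (Suc i) \<le> f i + scale k"
      using assms(2,3)[of i] by auto
    have "f (Suc i) \<notin> arc k (n + 1 + 1)"
      using assms(1)[OF Suc.prems] n(1) by (auto simp: clear_def)
    then have "f (Suc i) < gap_left k (n + 1) + scale k \<or> gap_left k (n + 1 + 1) < f (Suc i)"
      unfolding arc_def atLeastAtMost_iff add_diff_cancel_right' by linarith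
    then show ?case
      using IH step gap_left_Suc_ge[of k "n + 1"] by linarith
  qed
  with n(1) show ?thesis using that by blast
qed

section \<open>Differences up to 1/4\<close>

lemma narrow_window_step:
  assumes clear: "\<And>i. i < 14 \<Longrightarrow> clear p (x + real i * d)" and "even (n + p)"
    and narrow: "gap_left k (n + 1) = gap_left k n + 2 * scale k"
    and window: "\<And>i. i < 14 \<Longrightarrow>
      gap_left k n < x + real i * d \<and> x + real i * d < gap_left k (n + 1) + scale k"
  shows "d \<le> scale (Suc k)"
proof (rule ccontr)
  define l where "l = scale (Suc k)"
  assume "\<not> d \<le> scale (Suc k)"
  then have d: "l < d" by (simp add: l_def)
  have sc: "scale k = 5 * l" by (simp add: l_def scale_Suc[of k])
  define t where "t = x - gap_left k n"
  have t: "0 < t" "t + 13 * d < 15 * l"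
    using window[of 0] window[of 13] narrow sc by (simp_all add: t_def)
  \<comment> \<open>Both arcs have the parity of \<open>n\<close>. Since \<open>d > l\<close>, term
    3 lies beyond \<open>3 * l\<close>, hence beyond \<open>4 * l\<close>; symmetrically, term 10
    lies below \<open>12 * l\<close>, hence below \<open>11 * l\<close>. So seven steps cover less
    than \<open>7 * l\<close>.\<close>
  have "x + real 3 * d \<notin> arc (Suc k) (3 * n + 2)" "x + real 10 * d \<notin> arc (Suc k) (3 * (n + 1) + 1)"
    using clear[of 3] clear[of 10] \<open>even (n + p)\<close> unfolding clear_def by auto
  moreover have "arc (Suc k) (3 * n + 2) = {gap_left k n + 3 * l..gap_left k n + 4 * l}"
    using gap_left_triple(2,3)[of k n] by (simp add: arc_def add.commute flip: l_def)
  moreover have "arc (Suc k) (3 * (n + 1) + 1) = {gap_left k n + 11 * l..gap_left k n + 12 * l}"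
    using gap_left_triple(1,2)[of k "n + 1"] narrow sc by (simp add: arc_def algebra_simps flip: l_def)
  ultimately have "t + 3 * d < 3 * l \<or> 4 * l < t + 3 * d" "t + 10 * d < 11 * l \<or> 12 * l < t + 10 * d"
    by (auto simp: t_def)
  with t d show False by linarith
qed

lemma small_difference_step:
  assumes nonblue: "\<And>i. i < 14 \<Longrightarrow> clear 1 (x + real i * d)"
    and nonred: "\<And>i. 14 \<le> i \<Longrightarrow> i < 28 \<Longrightarrow> clear 0 (x + real i * d)"
    and d: "0 < d" "d \<le> scale k"
  shows "d \<le> scale (Suc k)"
proof -
  define x' where "x' = x + 14 * d"
  have nonred': "clear 0 (x' + real i * d)" if "i < 14" for i
    using nonred[of "14 + i"] that by (simp add: x'_def algebra_simps)
  obtain n where n: "even (n + 1)"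
    "\<And>i. i \<le> 13 \<Longrightarrow> gap_left k n < x + real i * d \<and> x + real i * d < gap_left k (n + 1) + scale k"
    by (rule clear_chain_window[of 13 1 "\<lambda>i. x + real i * d" k])
      (use nonblue d in \<open>auto simp: algebra_simps\<close>)
  obtain m where m: "even (m + 0)"
    "\<And>i. i \<le> 13 \<Longrightarrow> gap_left k m < x' + real i * d \<and> x' + real i * d < gap_left k (m + 1) + scale k"
    by (rule clear_chain_window[of 13 0 "\<lambda>i. x' + real i * d" k])
      (use nonred' d in \<open>auto simp: algebra_simps\<close>)
  have last: "x + 13 * d < gap_left k (n + 1) + scale k" "gap_left k n < x + 13 * d"
    and first: "gap_left k m < x + 14 * d" "x + 14 * d < gap_left k (m + 1) + scale k"
    using n(2)[of 13] m(2)[of 0] by (simp_all add: x'_def)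
  \<comment> \<open>Windows three or more indices apart are separated by at least
    \<open>3 * scale k\<close>, too far for the single step from term 13 to term 14.\<close>
  have "m < n + 3"
  proof (rule ccontr)
    assume "\<not> m < n + 3"
    then have "gap_left k (n + 1) + 4 * scale k \<le> gap_left k m"
      using gap_left_add_ge[of k "n + 1" 2] gap_left_mono[of "n + 3" m k]
      by (simp add: add.assoc)
    then show False using last first d scale_pos[of k] by linarith
  qed
  moreover have "n < m + 3"
  proof (rule ccontr)
    assume "\<not> n < m + 3"
    then have "gap_left k (m + 1) + 4 * scale k \<le> gap_left k n"
      using gap_left_add_ge[of k "m + 1" 2] gap_left_mono[of "m + 3" n k]
      by (simp add: add.assoc)
    then show False using last first d scale_pos[of k] by linarith
  qed
  ultimately have "m = n + 1 \<or> n = m + 1"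
    using n(1) m(1) by presburger
  \<comment> \<open>The middle arcs have consecutive indices, so at least one of them has minimal
    length.\<close>
  then have "\<not> 3 dvd n + 1 \<or> \<not> 3 dvd m + 1" by presburger
  then consider "\<not> 3 dvd n + 1" | "\<not> 3 dvd m + 1" by blast
  then show ?thesis
  proof cases
    case 1
    show ?thesis
      by (rule narrow_window_step[OF nonblue n(1) gap_left_Suc_eq[OF 1]]) (use n(2) in auto)
  next
    case 2
    show ?thesis
      by (rule narrow_window_step[OF nonred' m(1) gap_left_Suc_eq[OF 2]]) (use m(2) in auto)
  qed
qed

lemma no_AP_small_difference:
  assumes nonblue: "\<And>i. i < 14 \<Longrightarrow> clear 1 (x + real i * d)"
    and nonred: "\<And>i. 14 \<le> i \<Longrightarrow> i < 28 \<Longrightarrow> clear 0 (x + real i * d)"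
    and d: "0 < d" "d \<le> 1 / 4"
  shows False
proof -
  have "d \<le> scale k" for k
  proof (induction k)
    case 0
    then show ?case using d by (simp add: scale_def)
  next
    case (Suc k)
    then show ?case using small_difference_step nonblue nonred d(1) by blast
  qed
  moreover obtain k where "scale k < d"
    using scale_arbitrarily_small[OF d(1)] by blast
  ultimately show False by (simp add: not_less[symmetric])
qed

section \<open>Differences near 1/2\<close>

lemma near_half_step:
  assumes ev: "\<And>i. i \<le> 6 \<Longrightarrow> clear 1 (v + real (2 * i) * e)"
    and od: "\<And>i. i \<le> 5 \<Longrightarrow> clear 0 (v + real (2 * i + 1) * e)"
    and e: "0 < e" "2 * e \<le> scale k"
  shows "2 * e \<le> scale (Suc k)"
proof -
  obtain n where n: "even (n + 1)" "\<And>i. i \<le> 6 \<Longrightarrow>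
      gap_left k n < v + real (2 * i) * e \<and> v + real (2 * i) * e < gap_left k (n + 1) + scale k"
    by (rule clear_chain_window[of 6 1 "\<lambda>i. v + real (2 * i) * e" k])
      (use ev e in \<open>auto simp: algebra_simps\<close>)
  obtain m where m: "even (m + 0)" "\<And>i. i \<le> 5 \<Longrightarrow>
      gap_left k m < v + real (2 * i + 1) * e \<and> v + real (2 * i + 1) * e < gap_left k (m + 1) + scale k"
    by (rule clear_chain_window[of 5 0 "\<lambda>i. v + real (2 * i + 1) * e" k])
      (use od e in \<open>auto simp: algebra_simps\<close>)
  have bounds: "gap_left k n < v" "v + 12 * e < gap_left k (n + 1) + scale k"
    "gap_left k m < v + e" "v + 11 * e < gap_left k (m + 1) + scale k"
    using n(2)[of 0] n(2)[of 6] m(2)[of 0] m(2)[of 5] by simp_all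
  have "n \<noteq> m" using n(1) m(1) by auto
  then consider "n + 1 \<le> m" | "m + 1 \<le> n" by linarith
  \<comment> \<open>Windows of opposite parity share at most one gap, and eleven consecutive steps
    of length \<open>e\<close> fit into it.\<close>
  then have "10 * e < scale k"
  proof cases
    case 1
    then have "gap_left k (n + 1) \<le> gap_left k m"
      by (rule gap_left_mono)
    then show ?thesis using bounds e(1) by linarith
  next
    case 2
    then have "gap_left k (m + 1) \<le> gap_left k n"
      by (rule gap_left_mono)
    then show ?thesis using bounds e(1) by linarith
  qed
  then show ?thesis using scale_Suc[of k] by simp
qed

lemma no_AP_near_half:
  assumes nonblue: "\<And>i. i < 14 \<Longrightarrow> clear 1 (x + real i * d)"
    and d: "3 / 8 \<le> d" "d < 1 / 2"
  shows False
proof -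
  define e where "e = 1 / 2 - d"
  \<comment> \<open>Point \<open>i\<close> of the new sequence is term \<open>12 - i\<close> moved
    back by \<open>(12 - i) / 2\<close>; the reversal makes its difference \<open>e\<close>
    positive. As 12 is even, \<open>v\<close> itself avoids blue.\<close>
  define v where "v = x - 12 * e"
  have e: "0 < e" "2 * e \<le> 1 / 4" using d by (auto simp: e_def)
  have shifted: "clear (1 + int i) (v + real i * e)" if "i \<le> 12" for i
  proof -
    have "clear (1 - int (12 - i)) (x + real (12 - i) * d - real (12 - i) / 2)"
      using clear_translate[OF nonblue[of "12 - i"], of "- int (12 - i)"] by simp
    moreover have "x + real (12 - i) * d - real (12 - i) / 2 = v + real i * e"
      using that by (simp add: v_def e_def of_nat_diff field_simps)
    ultimately show ?thesis
      using that by (auto simp: of_nat_diff intro: clear_cong[rotated])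
  qed
  have ev: "clear 1 (v + real (2 * i) * e)" if "i \<le> 6" for i
    using clear_cong[OF _ shifted[of "2 * i"], of 1] that by simp
  have od: "clear 0 (v + real (2 * i + 1) * e)" if "i \<le> 5" for i
    using clear_cong[OF _ shifted[of "2 * i + 1"], of 0] that by simp
  have "2 * e \<le> scale k" for k
  proof (induction k)
    case 0
    then show ?case using e by (simp add: scale_def)
  next
    case (Suc k)
    then show ?case using near_half_step ev od e(1) by blast
  qed
  moreover obtain k where "scale k < 2 * e"
    using scale_arbitrarily_small[of "2 * e"] e(1) by auto
  ultimately show False by (simp add: not_less[symmetric])
qed

section \<open>Differences between 1/4 and 3/8\<close>

lemma no_AP_near_third:
  assumes nonblue: "\<And>i. i < 14 \<Longrightarrow> clear 1 (x + real i * d)"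
    and nonred: "\<And>i. 14 \<le> i \<Longrightarrow> i < 28 \<Longrightarrow> clear 0 (x + real i * d)"
    and d: "1 / 4 < d" "d < 3 / 8"
  shows False
proof -
  obtain n where n: "even (n + 1)" "gap_left 0 n < x" "x < gap_left 0 (n + 1) + scale 0"
    using clear_window[OF nonblue[of 0], of 0] by (simp del: gap_left.simps) blast
  then obtain N where N: "n = 2 * N - 1" by (metis add_diff_cancel_right' dvdE)
  \<comment> \<open>In this coordinate the red arcs start at the integers \<open>c\<close> and the
    blue ones at \<open>c + 1/2\<close>.\<close>
  define y where "y i = x + real i * d - N" for i
  have y_add: "y (i + j) = y i + real j * d" for i j
    by (simp add: y_def algebra_simps)
  have y0: "- 1 / 4 < y 0" "y 0 < 1 / 2"
    using n(2,3) by (simp_all add: N y_def scale_def field_simps)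
  have blue: "y i < c + 1 / 2 \<or> c + 3 / 4 < y i" if "i < 14" for i and c :: int
  proof -
    have "x + real i * d \<notin> arc 0 (2 * (N + c) + 1)"
      using nonblue[OF that] unfolding clear_def by simp
    then show ?thesis by (auto simp: arc_def scale_def y_def field_simps)
  qed
  have red: "y i < c \<or> c + 1 / 4 < y i" if "14 \<le> i" "i < 28" for i and c :: int
  proof -
    have "x + real i * d \<notin> arc 0 (2 * (N + c))"
      using nonred[OF that] unfolding clear_def by simp
    then show ?thesis by (auto simp: arc_def scale_def y_def field_simps)
  qed
  obtain j where j: "j \<le> 2" "y j < 1 / 2" "1 / 2 \<le> y (j + 1)"
  proof -
    have "1 / 2 \<le> y 3" using y0 y_add[of 0 3] d by simp
    then consider "1 / 2 \<le> y 1" | "y 1 < 1 / 2" "1 / 2 \<le> y 2" | "y 2 < 1 / 2" "1 / 2 \<le> y 3"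
      by linarith
    then show ?thesis
      using that[of 0] that[of 1] that[of 2] y0 by cases (simp_all add: numeral_eq_Suc)
  qed
  \<comment> \<open>As \<open>3 * d < 9/8\<close>, three steps from before one blue arc cannot pass
    the next; as \<open>3 * d > 3/4\<close>, three steps from beyond one reach at least the start of
    the next.\<close>
  have jump: "y (j + 3 * i) < real i + 1 / 2 \<and> real i + 3 / 4 < y (j + 3 * i + 1)" if "i \<le> 3" for i
    using that
  proof (induction i)
    case 0
    then show ?case using j blue[of "j + 1" 0] by auto
  next
    case (Suc i)
    let ?u = "y (j + 3 * i)"
    have u: "?u < real i + 1 / 2" "real i + 3 / 4 < ?u + d"
      using Suc y_add[of "j + 3 * i" 1] by simp_all
    have "y (j + 3 * Suc i) = ?u + 3 * d" "y (j + 3 * Suc i + 1) = ?u + 4 * d"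
      using y_add[of "j + 3 * i" 3] y_add[of "j + 3 * i" 4] by (simp_all add: algebra_simps)
    then show ?case
      using u d j(1) Suc.prems blue[of "j + 3 * Suc i" "int i + 1"]
        blue[of "j + 3 * Suc i + 1" "int i + 1"]
      by auto
  qed
  \<comment> \<open>These bounds give \<open>13/40 < d < 11/32\<close>, which puts term
    \<open>j + 14\<close> into the red arc from 5 to 21/4.\<close>
  have "y j + d > 3 / 4" "y j + 9 * d < 7 / 2" "y j + 10 * d > 15 / 4"
    using jump[of 0] jump[of 3] y_add[of j 1] y_add[of j 9] y_add[of j 10] by (simp_all add: add.commute)
  moreover have "y j + 14 * d < 5 \<or> 21 / 4 < y j + 14 * d"
    using red[of "j + 14" 5] j(1) y_add[of j 14] by simp
  ultimately show False using j(2) by linarith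
qed

section \<open>Combining the ranges and the two signs\<close>

lemma no_AP_positive_difference:
  assumes "\<And>i. i < 14 \<Longrightarrow> clear 1 (x + real i * d)"
    and "\<And>i. 14 \<le> i \<Longrightarrow> i < 28 \<Longrightarrow> clear 0 (x + real i * d)"
    and "0 < d" "d < 1 / 2"
  shows False
proof -
  consider "d \<le> 1 / 4" | "1 / 4 < d" "d < 3 / 8" | "3 / 8 \<le> d" by linarith
  then show False
    using no_AP_small_difference no_AP_near_third no_AP_near_half assms by cases blast+
qed

theorem theorem10:
  shows "\<not> (\<exists>x d. d \<in> {-1/2<..<0} \<union> {0<..<1/2} \<and> is_AP limit_colouring 14 14 x d)"
proof
  assume "\<exists>x d. d \<in> {-1/2<..<0} \<union> {0<..<1/2} \<and> is_AP limit_colouring 14 14 x d"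
  then obtain x d :: real where d: "d \<in> {-1/2<..<0} \<union> {0<..<1/2}"
    and AP: "is_AP limit_colouring 14 14 x d"
    by blast
  have nonblue: "clear 1 (x + real i * d)" if "i < 14" for i
    using AP that by (intro clear_if_not_coloured) (simp add: is_AP_def)
  have nonred: "clear 0 (x + real i * d)" if "14 \<le> i" "i < 28" for i
    using AP that by (intro clear_if_not_coloured) (simp add: is_AP_def)
  show False
  proof (cases "0 < d")
    case True
    then show False using no_AP_positive_difference[OF nonblue nonred] d by auto
  next
    case False
    \<comment> \<open>Reading the progression backwards makes the difference positive but puts the
      non-red half first; the half-turn exchanges the colours again.\<close>
    define x' where "x' = x + 27 * d + 1 / 2"
    have rev: "x' + real i * (- d) = x + real (27 - i) * d + 1 / 2" if "i < 28" for i
      using that by (simp add: x'_def of_nat_diff algebra_simps)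
    have "clear 1 (x' + real i * (- d))" if "i < 14" for i
      using clear_translate[OF nonred[of "27 - i"], of 1] rev[of i] that by simp
    moreover have "clear 0 (x' + real i * (- d))" if "14 \<le> i" "i < 28" for i
      using clear_cong[OF _ clear_translate[OF nonblue[of "27 - i"], of 1], of 0] rev[of i] that by simp
    ultimately show False
      using no_AP_positive_difference[of x' "- d"] False d by auto
  qed
qed

end
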